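(* Let $\pi_3$ be the five-dimensional complex associative algebra with basis $e_1,\dots,e_5$ and nonzero products $e_1e_1=e_2$, $e_1e_2=e_2e_1=e_3$, $e_1e_4=e_5$, $e_4e_4=e_5$ (all other products of basis elements are zero). A linear operator on $\pi_3$ is a local derivation if and only if its matrix has the form $$\begin{pmatrix} b_{1,1} & 0 & 0 & 0 & 0 \\ b_{2,1} & 2b_{1,1} & 0 & 0 & 0 \\ b_{3,1} & b_{3,2} & 3b_{1,1} & b_{3,4} & 0 \\ 0 & 0 & 0 & b_{1,1} & 0 \\ b_{5,1} & 0 & 0 & b_{5,4} & 2b_{1,1} \end{pmatrix}$$ with $b_{1,1},b_{2,1},b_{3,1},b_{3,2},b_{3,4},b_{5,1},b_{5,4}\in\mathbb{C}$.
   Context: The matrix of a linear operator $T$ is taken with respect to the basis $e_1,\dots,e_5$, with the $j$-th column giving the coordinates of $T(e_j)$. A derivation of an algebra $A$ is a linear map $D$ with $D(xy)=D(x)y+xD(y)$ for all $x,y\in A$. A linear map $\nabla:A\to A$ is a local derivation if for every $x\in A$ there is a derivation $D_x$ of $A$ (depending on $x$) with $\nabla(x)=D_x(x)$. *)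

theory Defs
  imports "HOL-Analysis.Analysis"
begin

text \<open>Index type for the basis e1,...,e5 of pi_3.\<close>
datatype idx = I1 | I2 | I3 | I4 | I5

lemma UNIV_idx: "(UNIV :: idx set) = {I1, I2, I3, I4, I5}"
  by (auto intro: idx.exhaust)

instance idx :: finite
  by standard (simp add: UNIV_idx)

text \<open>The underlying vector space of pi_3: complex^idx, e_j = axis j 1.\<close>
type_synonym pi3 = "complex ^ idx"

text \<open>Multiplication of pi_3, bilinear extension of
  e1e1 = e2, e1e2 = e2e1 = e3, e1e4 = e5, e4e4 = e5, other products zero.\<close>
definition pi3_mult :: "pi3 \<Rightarrow> pi3 \<Rightarrow> pi3" where
  "pi3_mult x y = (\<chi> k. case k of
      I1 \<Rightarrow> 0
    | I2 \<Rightarrow> x$I1 * y$I1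
    | I3 \<Rightarrow> x$I1 * y$I2 + x$I2 * y$I1
    | I4 \<Rightarrow> 0
    | I5 \<Rightarrow> x$I1 * y$I4 + x$I4 * y$I4)"

text \<open>Complex-linear maps of pi_3.\<close>
definition pi3_linear :: "(pi3 \<Rightarrow> pi3) \<Rightarrow> bool" where
  "pi3_linear T \<longleftrightarrow> Vector_Spaces.linear (*s) (*s) T"

definition pi3_derivation :: "(pi3 \<Rightarrow> pi3) \<Rightarrow> bool" where
  "pi3_derivation D \<longleftrightarrow> pi3_linear D \<and>
     (\<forall>x y. D (pi3_mult x y) = pi3_mult (D x) y + pi3_mult x (D y))"

definition pi3_local_derivation :: "(pi3 \<Rightarrow> pi3) \<Rightarrow> bool" where
  "pi3_local_derivation T \<longleftrightarrow> pi3_linear T \<and>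
     (\<forall>x. \<exists>D. pi3_derivation D \<and> T x = D x)"

end

theory Submission
  imports Defs
begin

text \<open>Evaluating a derivation on products of basis vectors shows that derivations of pi_3 are
  exactly the matrices of the stated shape with b32 = 2 b21. At a single point x, however, the only place
  where b32 enters, the third coordinate b31 x1 + b32 x2 + ..., can be matched by a derivation:
  adjust b31 if x1 is nonzero, and take b21 = b32/2 if x1 = 0. So every matrix of this shape
  is a local derivation. Conversely, comparing a local derivation with derivations at the basis
  vectors and at e1+e4, e2+e4, e2+e5, e3+e5 forces the zero pattern and the diagonal.\<close>

lemma sum_UNIV_idx: "(\<Sum>j\<in>UNIV. f j) = f I1 + f I2 + f I3 + f I4 + f I5"
  by (simp add: UNIV_idx add.assoc)

lemma all_idx: "(\<forall>i. P i) \<longleftrightarrow> P I1 \<and> P I2 \<and> P I3 \<and> P I4 \<and> P I5"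
  by (metis idx.exhaust)

definition pi3_lder_matrix ::
    "complex \<Rightarrow> complex \<Rightarrow> complex \<Rightarrow> complex \<Rightarrow> complex \<Rightarrow> complex \<Rightarrow> complex \<Rightarrow> complex^idx^idx"
  where
 "pi3_lder_matrix b11 b21 b31 b32 b34 b51 b54 = (\<chi> i j. case (i, j) of
           (I1, I1) \<Rightarrow> b11
         | (I2, I1) \<Rightarrow> b21 | (I2, I2) \<Rightarrow> 2 * b11
         | (I3, I1) \<Rightarrow> b31 | (I3, I2) \<Rightarrow> b32 | (I3, I3) \<Rightarrow> 3 * b11 | (I3, I4) \<Rightarrow> b34
         | (I4, I4) \<Rightarrow> b11
         | (I5, I1) \<Rightarrow> b51 | (I5, I4) \<Rightarrow> b54 | (I5, I5) \<Rightarrow> 2 * b11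
         | _ \<Rightarrow> 0)"

lemma pi3_lder_matrix_mult_vec:
  "pi3_lder_matrix b11 b21 b31 b32 b34 b51 b54 *v x = (\<chi> k. case k of
      I1 \<Rightarrow> b11 * x$I1
    | I2 \<Rightarrow> b21 * x$I1 + 2 * b11 * x$I2
    | I3 \<Rightarrow> b31 * x$I1 + b32 * x$I2 + 3 * b11 * x$I3 + b34 * x$I4
    | I4 \<Rightarrow> b11 * x$I4
    | I5 \<Rightarrow> b51 * x$I1 + b54 * x$I4 + 2 * b11 * x$I5)"
  by (simp add: vec_eq_iff all_idx pi3_lder_matrix_def matrix_vector_mult_def sum_UNIV_idx)

lemma pi3_linear_iff_matrix: "pi3_linear T \<longleftrightarrow> T = (*v) (matrix T)"
proof
  assume "pi3_linear T"
  then show "T = (*v) (matrix T)"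
    by (simp add: pi3_linear_def matrix_works fun_eq_iff)
next
  assume "T = (*v) (matrix T)"
  then show "pi3_linear T"
    unfolding pi3_linear_def by (metis matrix_vector_mul_linear_gen)
qed

lemma pi3_derivation_matrix_form:
  fixes m :: "complex^idx^idx"
  assumes der: "\<And>x y. m *v pi3_mult x y = pi3_mult (m *v x) y + pi3_mult x (m *v y)"
  shows "m = pi3_lder_matrix (m$I1$I1) (m$I2$I1) (m$I3$I1) (2 * m$I2$I1) (m$I3$I4)
      (m$I5$I1) (m$I5$I4)"
proof -
  have "\<forall>i j k. (m *v pi3_mult (axis i 1) (axis j 1)) $ k
      = (pi3_mult (m *v axis i 1) (axis j 1) + pi3_mult (axis i 1) (m *v axis j 1)) $ k"
    using der by simp
  note on_basis = this[simplified all_idx sum_UNIV_idx pi3_mult_def axis_def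
      matrix_vector_mult_def, simplified]
  have "m$I5$I5 = m$I1$I1 + m$I4$I1 + m$I4$I4" "m$I5$I5 = 2 * m$I4$I4 + m$I1$I4"
       "m$I4$I1 = 0" "m$I1$I4 = 0"
    using on_basis by blast+
  then have "m$I4$I4 = m$I1$I1"
    by algebra
  then show ?thesis
    using on_basis by (simp add: vec_eq_iff all_idx pi3_lder_matrix_def)
qed

lemma pi3_derivation_iff:
  "pi3_derivation D \<longleftrightarrow>
     (\<exists>b11 b21 b31 b34 b51 b54. D = (*v) (pi3_lder_matrix b11 b21 b31 (2 * b21) b34 b51 b54))"
proof
  assume D: "pi3_derivation D"
  then have "D = (*v) (matrix D)"
    by (simp add: pi3_derivation_def pi3_linear_iff_matrix)
  with D pi3_derivation_matrix_form[of "matrix D"] show "\<exists>b11 b21 b31 b34 b51 b54.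
      D = (*v) (pi3_lder_matrix b11 b21 b31 (2 * b21) b34 b51 b54)"
    unfolding pi3_derivation_def by metis
next
  assume "\<exists>b11 b21 b31 b34 b51 b54. D = (*v) (pi3_lder_matrix b11 b21 b31 (2 * b21) b34 b51 b54)"
  then show "pi3_derivation D"
    by (auto simp: pi3_derivation_def pi3_linear_def matrix_vector_mul_linear_gen
        pi3_lder_matrix_mult_vec vec_eq_iff all_idx pi3_mult_def algebra_simps)
qed

lemma pi3_lder_matrix_pointwise_derivation:
  "\<exists>b21' b31'. pi3_lder_matrix b11 b21 b31 b32 b34 b51 b54 *v x
      = pi3_lder_matrix b11 b21' b31' (2 * b21') b34 b51 b54 *v x"
proof (cases "x$I1 = 0")
  case True
  then show ?thesis
    by (intro exI[of _ "b32 / 2"] exI[of _ 0])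
      (simp add: pi3_lder_matrix_mult_vec vec_eq_iff all_idx)
next
  case False
  then show ?thesis
    by (intro exI[of _ b21] exI[of _ "b31 + (b32 - 2 * b21) * x$I2 / x$I1"])
      (simp add: pi3_lder_matrix_mult_vec vec_eq_iff all_idx field_simps)
qed

lemma pi3_lder_matrix_if_pointwise_derivation:
  fixes M :: "complex^idx^idx"
  assumes pointwise: "\<And>x. \<exists>b11 b21 b31 b34 b51 b54.
      M *v x = pi3_lder_matrix b11 b21 b31 (2 * b21) b34 b51 b54 *v x"
  shows "M = pi3_lder_matrix (M$I1$I1) (M$I2$I1) (M$I3$I1) (M$I3$I2) (M$I3$I4)
      (M$I5$I1) (M$I5$I4)"
proof -
  have coords: "\<exists>b11 b21 b31 b34 b51 b54. \<forall>k. (\<Sum>j\<in>UNIV. M$k$j * x$j)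
      = (pi3_lder_matrix b11 b21 b31 (2 * b21) b34 b51 b54 *v x) $ k" for x
    using pointwise[of x] by (simp add: vec_eq_iff matrix_vector_mult_def)
  note coords_simps = sum_UNIV_idx pi3_lder_matrix_mult_vec all_idx axis_def
  have zeros: "M$I4$I1 = 0" "M$I1$I2 = 0" "M$I4$I2 = 0" "M$I5$I2 = 0"
      "M$I1$I3 = 0" "M$I2$I3 = 0" "M$I4$I3 = 0" "M$I5$I3 = 0" "M$I1$I4 = 0" "M$I2$I4 = 0"
      "M$I1$I5 = 0" "M$I2$I5 = 0" "M$I3$I5 = 0" "M$I4$I5 = 0"
    using coords[of "axis I1 1"] coords[of "axis I2 1"] coords[of "axis I3 1"]
      coords[of "axis I4 1"] coords[of "axis I5 1"]
    by (auto simp: coords_simps)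
  have "M$I4$I4 = M$I1$I1"
    using coords[of "axis I1 1 + axis I4 1"] zeros by (auto simp: coords_simps)
  moreover have "M$I2$I2 = 2 * M$I4$I4"
    using coords[of "axis I2 1 + axis I4 1"] zeros by (auto simp: coords_simps)
  moreover have "M$I5$I5 = M$I2$I2"
    using coords[of "axis I2 1 + axis I5 1"] zeros by (auto simp: coords_simps)
  moreover have "2 * M$I3$I3 = 3 * M$I5$I5"
    using coords[of "axis I3 1 + axis I5 1"] zeros by (auto simp: coords_simps)
  ultimately show ?thesis
    using zeros by (simp add: vec_eq_iff all_idx pi3_lder_matrix_def)
qed

theorem theorem5p4:
  fixes T :: "pi3 \<Rightarrow> pi3"
  assumes "pi3_linear T"
  shows "pi3_local_derivation T \<longleftrightarrow>
    (\<exists>b11 b21 b31 b32 b34 b51 b54 :: complex.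
       matrix T = (\<chi> i j. case (i, j) of
           (I1, I1) \<Rightarrow> b11
         | (I2, I1) \<Rightarrow> b21 | (I2, I2) \<Rightarrow> 2 * b11
         | (I3, I1) \<Rightarrow> b31 | (I3, I2) \<Rightarrow> b32 | (I3, I3) \<Rightarrow> 3 * b11 | (I3, I4) \<Rightarrow> b34
         | (I4, I4) \<Rightarrow> b11
         | (I5, I1) \<Rightarrow> b51 | (I5, I4) \<Rightarrow> b54 | (I5, I5) \<Rightarrow> 2 * b11
         | _ \<Rightarrow> 0))"
proof -
  have T: "T = (*v) (matrix T)"
    using assms by (simp add: pi3_linear_iff_matrix)
  have "pi3_local_derivation T \<longleftrightarrow> (\<forall>x. \<exists>b11 b21 b31 b34 b51 b54.
      matrix T *v x = pi3_lder_matrix b11 b21 b31 (2 * b21) b34 b51 b54 *v x)"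
    unfolding pi3_local_derivation_def pi3_derivation_iff using assms T by metis
  also have "\<dots> \<longleftrightarrow> (\<exists>b11 b21 b31 b32 b34 b51 b54.
      matrix T = pi3_lder_matrix b11 b21 b31 b32 b34 b51 b54)"
    by (metis pi3_lder_matrix_if_pointwise_derivation pi3_lder_matrix_pointwise_derivation)
  finally show ?thesis
    by (simp only: pi3_lder_matrix_def)
qed

end
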